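(* Let $(\mathcal V^h(t),\varkappa^h(t),\vec X^h(t),\kappa^h(t))$ be a solution of the semidiscrete scheme (S1)--(S4) given in the context. Then for all $t\in(0,T]$ $$\frac{d}{dt}E_{\overline\varkappa}(\vec X^h(t),\varkappa^h(t))=-2\pi\,\bigl(\vec X^h\cdot\vec e_1\,\mathcal V^h,\ \mathcal V^h\,|\vec X^h_\rho|\bigr)\le 0.$$
   Context: Domain and spaces. Either $\mathbb I=\mathbb R/\mathbb Z$ (with $\partial\mathbb I=\emptyset$) or $\mathbb I=(0,1)$ (with $\partial\mathbb I=\{0,1\}$). $\vec e_1,\vec e_2$ is the standard basis of $\mathbb R^2$; $(\cdot)^\perp$ is clockwise rotation by $\pi/2$; $(\cdot,\cdot)$ is the $L^2$-inner product on $\mathbb I$; $\overline\varkappa\in\mathbb R$ is a given constant. Let $J\in\mathbb N$, $h=1/J$, $\rho_j=jh$, $\mathbb I_j=[\rho_{j-1},\rho_j]$, $j=1,\ldots,J$ (with $\rho_0=\rho_J$ identified if $\mathbb I=\mathbb R/\mathbb Z$). $V^h$ is the space of continuous functions on $\overline{\mathbb I}$ that are affine on each $\mathbb I_j$, and $\underline V_\partial^h=\{\vec\eta\in[V^h]^2:\ \vec\eta(\rho)\cdot\vec e_1=0\ \forall\rho\in\partial\mathbb I\}$. The mass-lumped product is $(u,v)^h=\frac h2\sum_{j=1}^J[(u\cdot v)(\rho_j^-)+(u\cdot v)(\rho_{j-1}^+)]$ for piecewise continuous $u,v$ with possible jumps at nodes. Energy: $E_{\overline\varkappa}(\vec X,\varkappa)=\pi\int_{\mathbb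 I}\vec X\cdot\vec e_1\,(\varkappa-\overline\varkappa)^2\,|\vec X_\rho|\,d\rho$. Standing assumption: for all $t\in[0,T]$, $\vec X^h(\rho,t)\cdot\vec e_1>0$ in $\overline{\mathbb I}\setminus\partial\mathbb I$ and $|\vec X^h_\rho|>0$ in $\overline{\mathbb I}$. Set $\vec\tau^h=\vec X^h_\rho|\vec X^h_\rho|^{-1}$, $\vec\nu^h=-(\vec\tau^h)^\perp$. Subscripts $t$ and $\rho$ denote partial derivatives; solutions are understood to be differentiable in time. Semidiscrete scheme. Given $\vec X^h(0)\in\underline V_\partial^h$ and $\varkappa^h(0)\in V^h$, for each $t\in(0,T]$ find $\mathcal V^h(t),\varkappa^h(t),\kappa^h(t)\in V^h$ and $\vec X^h(t)\in\underline V_\partial^h$ such that (S1) for all $\varphi^h\in V^h$: $(\vec X^h\cdot\vec e_1\,\mathcal V^h,\varphi^h|\vec X^h_\rho|)-(\vec X^h\cdot\vec e_1\,\varkappa^h_\rho,\varphi^h_\rho|\vec X^h_\rho|^{-1})+2(\vec\nu^h\cdot\vec e_1\,\kappa^h(\varkappa^h-\overline\varkappa),\varphi^h|\vec X^h_\rho|)+\frac12(\vec X^h\cdot\vec e_1\,[(\varkappa^h)^2-\overline\varkappa^2]\varkappa^h,\varphi^h|\vec X^h_\rho|)=0$; (S2) for all $\chi^h\in V^h$: $(\vec X^h\cdot\vec e_1\,\varkappa^h_t,\chi^h|\vec X^h_\rho|)+\frac12(\vec X^h_t\cdot\vec e_1\,|\vec X^h_\rho|+\vec X^h\cdot\vec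 e_1\,([\vec X^h_t]_\rho\cdot\vec\tau^h),(\varkappa^h-\overline\varkappa)\chi^h)+(\vec X^h\cdot\vec e_1\,\mathcal V^h_\rho,\chi^h_\rho|\vec X^h_\rho|^{-1})-2(\vec\nu^h\cdot\vec e_1\,\kappa^h\mathcal V^h,\chi^h|\vec X^h_\rho|)-\frac12(\vec X^h\cdot\vec e_1\,(\varkappa^h+\overline\varkappa)\varkappa^h\mathcal V^h,\chi^h|\vec X^h_\rho|)-\frac12(\vec X^h\cdot\vec e_1\,(\vec X^h_t\cdot\vec\tau^h),\varkappa^h_\rho\chi^h-(\varkappa^h-\overline\varkappa)\chi^h_\rho)=0$; (S3) for all $\xi^h\in V^h$: $(\vec X^h_t\cdot\vec\nu^h,\xi^h|\vec X^h_\rho|)^h-(\mathcal V^h,\xi^h|\vec X^h_\rho|)=0$; (S4) for all $\vec\eta^h\in\underline V_\partial^h$: $(\kappa^h\vec\nu^h,\vec\eta^h|\vec X^h_\rho|)^h+(\vec X^h_\rho,\vec\eta^h_\rho|\vec X^h_\rho|^{-1})=0$. *)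

theory Defs
  imports "HOL-Analysis.Analysis"
begin

section \<open>The reference domain and the finite element spaces\<close>

datatype domain = Circle | Interval

text \<open>
  \<open>Circle\<close> is $\mathbb R/\mathbb Z$ and \<open>Interval\<close> is $(0,1)$. In both cases a function on the
  (closed) domain is represented by a function on the reals of which only the values on
  \<open>{0..1}\<close> matter; on the circle the values at \<open>0\<close> and \<open>1\<close> have to agree.
\<close>

fun bdry :: "domain \<Rightarrow> real set" where
  "bdry Circle = {}"
| "bdry Interval = {0, 1}"

definition node :: "nat \<Rightarrow> nat \<Rightarrow> real" where
  "node J j = real j * (1 / real J)"

definition elt :: "nat \<Rightarrow> nat \<Rightarrow> real set" where
  "elt J j = {node J (j - 1)..node J j}"

definition Vh :: "domain \<Rightarrow> nat \<Rightarrow> (real \<Rightarrow> real) set" where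
  "Vh D J = {f. continuous_on {0..1} f
              \<and> (\<forall>j\<in>{1..J}. \<exists>a b. \<forall>\<rho>\<in>elt J j. f \<rho> = a + b * \<rho>)
              \<and> (D = Circle \<longrightarrow> f 0 = f 1)}"

abbreviation e1 :: "real ^ 2" where
  "e1 \<equiv> axis 1 1"

definition Vh_bdry :: "domain \<Rightarrow> nat \<Rightarrow> (real \<Rightarrow> real ^ 2) set" where
  "Vh_bdry D J = {\<eta>. (\<forall>i. (\<lambda>\<rho>. \<eta> \<rho> $ i) \<in> Vh D J) \<and> (\<forall>\<rho>\<in>bdry D. \<eta> \<rho> \<bullet> e1 = 0)}"

section \<open>Inner products\<close>

definition L2 :: "(real \<Rightarrow> 'a::real_inner) \<Rightarrow> (real \<Rightarrow> 'a) \<Rightarrow> real" where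
  "L2 u v = integral {0..1} (\<lambda>\<rho>. u \<rho> \<bullet> v \<rho>)"

text \<open>The one-sided limits are those of the product \<open>u \<bullet> v\<close>.\<close>

definition lumped :: "nat \<Rightarrow> (real \<Rightarrow> 'a::real_inner) \<Rightarrow> (real \<Rightarrow> 'a) \<Rightarrow> real" where
  "lumped J u v = (1 / real J) / 2 *
     (\<Sum>j=1..J. Lim (at_left (node J j)) (\<lambda>\<rho>. u \<rho> \<bullet> v \<rho>)
             + Lim (at_right (node J (j - 1))) (\<lambda>\<rho>. u \<rho> \<bullet> v \<rho>))"

section \<open>Derivatives and geometry\<close>

text \<open>
  For piecewise affine functions, \<open>d\<rho>\<close> is meaningful away from the nodes. It is used only
  under integrals and one-sided limits, where its values at the nodes play no role.
\<close>

definition d\<rho> :: "(real \<Rightarrow> 'a::real_normed_vector) \<Rightarrow> real \<Rightarrow> 'a" where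
  "d\<rho> f \<rho> = vector_derivative f (at \<rho>)"

text \<open>At \<open>t = T\<close> the time derivative is the left-sided one.\<close>

definition dt :: "real \<Rightarrow> (real \<Rightarrow> real \<Rightarrow> 'a::real_normed_vector) \<Rightarrow> real \<Rightarrow> real \<Rightarrow> 'a" where
  "dt T u t \<rho> = vector_derivative (\<lambda>s. u s \<rho>) (at t within {0..T})"

definition perp :: "real ^ 2 \<Rightarrow> real ^ 2" where
  "perp v = vector [v $ 2, - v $ 1]"

definition tangent :: "(real \<Rightarrow> real ^ 2) \<Rightarrow> real \<Rightarrow> real ^ 2" where
  "tangent X \<rho> = d\<rho> X \<rho> /\<^sub>R norm (d\<rho> X \<rho>)"

definition normal :: "(real \<Rightarrow> real ^ 2) \<Rightarrow> real \<Rightarrow> real ^ 2" where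
  "normal X \<rho> = - perp (tangent X \<rho>)"

definition energy :: "real \<Rightarrow> (real \<Rightarrow> real ^ 2) \<Rightarrow> (real \<Rightarrow> real) \<Rightarrow> real" where
  "energy vk0 X vk =
     pi * integral {0..1} (\<lambda>\<rho>. (X \<rho> \<bullet> e1) * (vk \<rho> - vk0)\<^sup>2 * norm (d\<rho> X \<rho>))"

section \<open>The semidiscrete scheme\<close>

text \<open>
  Dictionary: \<open>vk\<close> is $\varkappa^h$, \<open>kp\<close> is $\kappa^h$, \<open>V\<close> is $\mathcal V^h$, \<open>vk0\<close> is
  $\overline\varkappa$. The four equations are stated at a fixed time, so all arguments are
  functions of $\rho$; \<open>Xt\<close> and \<open>vkt\<close> are the time derivatives of \<open>X\<close> and \<open>vk\<close> at that time.
\<close>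

definition eq_S1 ::
  "domain \<Rightarrow> nat \<Rightarrow> real \<Rightarrow> (real \<Rightarrow> real) \<Rightarrow> (real \<Rightarrow> real) \<Rightarrow> (real \<Rightarrow> real ^ 2) \<Rightarrow> (real \<Rightarrow> real) \<Rightarrow> bool"
where
  "eq_S1 D J vk0 V vk X kp \<longleftrightarrow> (\<forall>\<phi>\<in>Vh D J.
       L2 (\<lambda>\<rho>. (X \<rho> \<bullet> e1) * V \<rho>) (\<lambda>\<rho>. \<phi> \<rho> * norm (d\<rho> X \<rho>))
     - L2 (\<lambda>\<rho>. (X \<rho> \<bullet> e1) * d\<rho> vk \<rho>) (\<lambda>\<rho>. d\<rho> \<phi> \<rho> * inverse (norm (d\<rho> X \<rho>)))
     + 2 * L2 (\<lambda>\<rho>. (normal X \<rho> \<bullet> e1) * kp \<rho> * (vk \<rho> - vk0)) (\<lambda>\<rho>. \<phi> \<rho> * norm (d\<rho> X \<rho>))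
     + 1 / 2 * L2 (\<lambda>\<rho>. (X \<rho> \<bullet> e1) * ((vk \<rho>)\<^sup>2 - vk0\<^sup>2) * vk \<rho>) (\<lambda>\<rho>. \<phi> \<rho> * norm (d\<rho> X \<rho>))
     = 0)"

definition eq_S2 ::
  "domain \<Rightarrow> nat \<Rightarrow> real \<Rightarrow> (real \<Rightarrow> real) \<Rightarrow> (real \<Rightarrow> real) \<Rightarrow> (real \<Rightarrow> real ^ 2) \<Rightarrow> (real \<Rightarrow> real)
    \<Rightarrow> (real \<Rightarrow> real) \<Rightarrow> (real \<Rightarrow> real ^ 2) \<Rightarrow> bool"
where
  "eq_S2 D J vk0 V vk X kp vkt Xt \<longleftrightarrow> (\<forall>\<zeta>\<in>Vh D J.
       L2 (\<lambda>\<rho>. (X \<rho> \<bullet> e1) * vkt \<rho>) (\<lambda>\<rho>. \<zeta> \<rho> * norm (d\<rho> X \<rho>))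
     + 1 / 2 * L2 (\<lambda>\<rho>. (Xt \<rho> \<bullet> e1) * norm (d\<rho> X \<rho>) + (X \<rho> \<bullet> e1) * (d\<rho> Xt \<rho> \<bullet> tangent X \<rho>))
                  (\<lambda>\<rho>. (vk \<rho> - vk0) * \<zeta> \<rho>)
     + L2 (\<lambda>\<rho>. (X \<rho> \<bullet> e1) * d\<rho> V \<rho>) (\<lambda>\<rho>. d\<rho> \<zeta> \<rho> * inverse (norm (d\<rho> X \<rho>)))
     - 2 * L2 (\<lambda>\<rho>. (normal X \<rho> \<bullet> e1) * kp \<rho> * V \<rho>) (\<lambda>\<rho>. \<zeta> \<rho> * norm (d\<rho> X \<rho>))
     - 1 / 2 * L2 (\<lambda>\<rho>. (X \<rho> \<bullet> e1) * (vk \<rho> + vk0) * vk \<rho> * V \<rho>) (\<lambda>\<rho>. \<zeta> \<rho> * norm (d\<rho> X \<rho>))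
     - 1 / 2 * L2 (\<lambda>\<rho>. (X \<rho> \<bullet> e1) * (Xt \<rho> \<bullet> tangent X \<rho>))
                  (\<lambda>\<rho>. d\<rho> vk \<rho> * \<zeta> \<rho> - (vk \<rho> - vk0) * d\<rho> \<zeta> \<rho>)
     = 0)"

definition eq_S3 ::
  "domain \<Rightarrow> nat \<Rightarrow> (real \<Rightarrow> real) \<Rightarrow> (real \<Rightarrow> real ^ 2) \<Rightarrow> (real \<Rightarrow> real ^ 2) \<Rightarrow> bool"
where
  "eq_S3 D J V X Xt \<longleftrightarrow> (\<forall>\<xi>\<in>Vh D J.
       lumped J (\<lambda>\<rho>. Xt \<rho> \<bullet> normal X \<rho>) (\<lambda>\<rho>. \<xi> \<rho> * norm (d\<rho> X \<rho>))
     - L2 V (\<lambda>\<rho>. \<xi> \<rho> * norm (d\<rho> X \<rho>)) = 0)"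

definition eq_S4 ::
  "domain \<Rightarrow> nat \<Rightarrow> (real \<Rightarrow> real ^ 2) \<Rightarrow> (real \<Rightarrow> real) \<Rightarrow> bool"
where
  "eq_S4 D J X kp \<longleftrightarrow> (\<forall>\<eta>\<in>Vh_bdry D J.
       lumped J (\<lambda>\<rho>. kp \<rho> *\<^sub>R normal X \<rho>) (\<lambda>\<rho>. norm (d\<rho> X \<rho>) *\<^sub>R \<eta> \<rho>)
     + L2 (d\<rho> X) (\<lambda>\<rho>. inverse (norm (d\<rho> X \<rho>)) *\<^sub>R d\<rho> \<eta> \<rho>) = 0)"

text \<open>
  A solution attains its initial data continuously, and its unknowns that occur in the scheme
  with a time derivative are differentiable in time on $(0,T]$. As the finite element spaces are
  finite-dimensional, it does not matter that this is required pointwise in $\rho$.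
\<close>

definition semidiscrete_solution ::
  "domain \<Rightarrow> nat \<Rightarrow> real \<Rightarrow> real \<Rightarrow> (real \<Rightarrow> real \<Rightarrow> real) \<Rightarrow> (real \<Rightarrow> real \<Rightarrow> real)
    \<Rightarrow> (real \<Rightarrow> real \<Rightarrow> real ^ 2) \<Rightarrow> (real \<Rightarrow> real \<Rightarrow> real) \<Rightarrow> bool"
where
  "semidiscrete_solution D J vk0 T V vk X kp \<longleftrightarrow>
     X 0 \<in> Vh_bdry D J \<and> vk 0 \<in> Vh D J
   \<and> (\<forall>\<rho>\<in>{0..1}. continuous_on {0..T} (\<lambda>s. X s \<rho>) \<and> continuous_on {0..T} (\<lambda>s. vk s \<rho>))
   \<and> (\<forall>t\<in>{0<..T}.
        (\<forall>\<rho>\<in>{0..1}. (\<lambda>s. X s \<rho>) differentiable (at t within {0..T})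
                  \<and> (\<lambda>s. vk s \<rho>) differentiable (at t within {0..T}))
      \<and> V t \<in> Vh D J \<and> vk t \<in> Vh D J \<and> kp t \<in> Vh D J \<and> X t \<in> Vh_bdry D J
      \<and> eq_S1 D J vk0 (V t) (vk t) (X t) (kp t)
      \<and> eq_S2 D J vk0 (V t) (vk t) (X t) (kp t) (dt T vk t) (dt T X t)
      \<and> eq_S3 D J (V t) (X t) (dt T X t)
      \<and> eq_S4 D J (X t) (kp t))"

text \<open>
  Positivity of $|\vec X^h_\rho|$ on the closed domain refers, at a node, to the derivatives from
  within both adjacent elements.
\<close>

definition admissible :: "domain \<Rightarrow> nat \<Rightarrow> (real \<Rightarrow> real ^ 2) \<Rightarrow> bool" where
  "admissible D J X \<longleftrightarrow>
     (\<forall>\<rho>\<in>{0..1} - bdry D. X \<rho> \<bullet> e1 > 0)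
   \<and> (\<forall>j\<in>{1..J}. \<forall>\<rho>\<in>elt J j. norm (vector_derivative X (at \<rho> within elt J j)) > 0)"

end

theory Submission
  imports Defs
begin

text \<open>
  The identity comes from testing \<open>eq_S2\<close> with \<open>\<zeta> = vk - vk0\<close> and \<open>eq_S1\<close> with \<open>\<phi> = V\<close>. In the former,
  the two terms with time derivatives make up the derivative of the energy divided by \<open>2 * pi\<close>:
  the length element \<open>norm (d\<rho> X)\<close> changes at the rate \<open>d\<rho> Xt \<bullet> tangent X\<close>. The last term vanishes
  by antisymmetry, and the three others are exactly those that \<open>eq_S1\<close> trades for the dissipation.
  The dissipation has a sign because \<open>X \<bullet> e1\<close> is nonnegative.

  What needs care is the differentiation under the integral. Time derivatives are only known to
  exist, pointwise in \<open>\<rho>\<close>, whereas the usual Leibniz rules ask for their continuity. The finite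
  element structure helps: on each element \<open>X\<close> and \<open>vk\<close> are affine and \<open>norm (d\<rho> X)\<close> is constant, so
  the energy density is a cubic polynomial in \<open>\<rho>\<close>, and Simpson's rule integrates it exactly
  (\<open>affine_product_has_integral_simpson\<close>). The energy of an element is thus an algebraic expression
  in finitely many point values, which can be differentiated in time directly. Since time
  derivatives of affine functions are again affine (\<open>affine_on_dt\<close>), Simpson's rule is also exact
  for the terms in \<open>eq_S2\<close>, so the result can be read as an integral again
  (\<open>element_energy_has_derivative\<close>).
\<close>

section \<open>Affine functions on an interval\<close>

definition affine_on :: "real set \<Rightarrow> (real \<Rightarrow> 'a::real_normed_vector) \<Rightarrow> bool" where
  "affine_on S f \<longleftrightarrow> (\<exists>A B. \<forall>x\<in>S. f x = A + x *\<^sub>R B)"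

lemma affine_on_interpolation:
  fixes f :: "real \<Rightarrow> 'a::real_normed_vector"
  assumes "affine_on {a..b} f" "a < b" "x \<in> {a..b}"
  shows "f x = f a + (x - a) *\<^sub>R ((f b - f a) /\<^sub>R (b - a))"
proof -
  obtain A B where AB: "\<And>x. x \<in> {a..b} \<Longrightarrow> f x = A + x *\<^sub>R B"
    using assms(1) by (auto simp: affine_on_def)
  have "f b - f a = (b - a) *\<^sub>R B"
    using AB[of a] AB[of b] assms(2) by (simp add: algebra_simps)
  then have "(f b - f a) /\<^sub>R (b - a) = B"
    using assms(2) by simp
  then show ?thesis
    using AB[of a] AB[of x] assms(2,3) by (simp add: algebra_simps)
qed

lemma affine_onI_point_slope:
  fixes f :: "real \<Rightarrow> 'a::real_normed_vector"
  assumes "\<And>x. x \<in> S \<Longrightarrow> f x = C + (x - a) *\<^sub>R B"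
  shows "affine_on S f"
  unfolding affine_on_def
  using assms by (intro exI[of _ "C - a *\<^sub>R B"] exI[of _ B]) (auto simp: algebra_simps)

lemma affine_on_has_vector_derivative_within:
  fixes f :: "real \<Rightarrow> 'a::real_normed_vector"
  assumes "affine_on {a..b} f" "a < b" "x \<in> {a..b}"
  shows "(f has_vector_derivative (f b - f a) /\<^sub>R (b - a)) (at x within {a..b})"
proof -
  have "((\<lambda>x. f a + (x - a) *\<^sub>R ((f b - f a) /\<^sub>R (b - a))) has_vector_derivative
          (f b - f a) /\<^sub>R (b - a)) (at x within {a..b})"
    by (auto intro!: derivative_eq_intros)
  then show ?thesis
    by (rule has_vector_derivative_transform[OF assms(3), rotated])
      (rule affine_on_interpolation[OF assms(1,2)])
qed

lemma affine_on_d\<rho>: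
  fixes f :: "real \<Rightarrow> 'a::real_normed_vector"
  assumes "affine_on {a..b} f" "x \<in> {a<..<b}"
  shows "d\<rho> f x = (f b - f a) /\<^sub>R (b - a)"
proof -
  have "(f has_vector_derivative (f b - f a) /\<^sub>R (b - a)) (at x within {a..b})"
    by (rule affine_on_has_vector_derivative_within) (use assms in auto)
  then have "(f has_vector_derivative (f b - f a) /\<^sub>R (b - a)) (at x)"
    using assms(2) at_within_Icc_at[of a x b] by simp
  then show ?thesis
    unfolding d\<rho>_def by (rule vector_derivative_at)
qed

lemma affine_on_inner:
  assumes "affine_on S f"
  shows "affine_on S (\<lambda>x. f x \<bullet> c)"
proof -
  obtain A B where "\<forall>x\<in>S. f x = A + x *\<^sub>R B"
    using assms unfolding affine_on_def by blast
  then show ?thesis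
    unfolding affine_on_def
    by (intro exI[of _ "A \<bullet> c"] exI[of _ "B \<bullet> c"]) (simp add: inner_add_left)
qed

lemma affine_on_diff_const:
  fixes f :: "real \<Rightarrow> 'a::real_normed_vector"
  assumes "affine_on S f"
  shows "affine_on S (\<lambda>x. f x - c)"
proof -
  obtain A B where "\<forall>x\<in>S. f x = A + x *\<^sub>R B"
    using assms unfolding affine_on_def by blast
  then show ?thesis
    unfolding affine_on_def by (intro exI[of _ "A - c"] exI[of _ B]) auto
qed

lemma affine_on_vec:
  fixes f :: "real \<Rightarrow> real ^ 'n"
  assumes "\<And>i. affine_on S (\<lambda>x. f x $ i)"
  shows "affine_on S f"
proof -
  have "\<forall>i. \<exists>A B. \<forall>x\<in>S. f x $ i = A + x *\<^sub>R B"
    using assms unfolding affine_on_def by blast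
  then obtain A B where "\<forall>i. \<forall>x\<in>S. f x $ i = A i + x *\<^sub>R B i"
    by metis
  then have "\<forall>x\<in>S. f x = (\<chi> i. A i) + x *\<^sub>R (\<chi> i. B i)"
    by (simp add: vec_eq_iff)
  then show ?thesis
    unfolding affine_on_def by blast
qed

section \<open>Simpson's rule\<close>

definition simpson :: "real \<Rightarrow> real \<Rightarrow> (real \<Rightarrow> real) \<Rightarrow> real" where
  "simpson a b g = (b - a) / 6 * (g a + 4 * g ((a + b) / 2) + g b)"

lemma cubic_has_integral_simpson:
  fixes c0 c1 c2 c3 :: real
  assumes "a \<le> b"
  defines "g \<equiv> \<lambda>x. c0 + c1 * x + c2 * x ^ 2 + c3 * x ^ 3"
  shows "(g has_integral simpson a b g) {a..b}"
proof -
  let ?G = "\<lambda>x::real. c0 * x + c1 * x ^ 2 / 2 + c2 * x ^ 3 / 3 + c3 * x ^ 4 / 4"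
  have "(?G has_vector_derivative g x) (at x within {a..b})" for x
    unfolding has_real_derivative_iff_has_vector_derivative[symmetric] g_def
    by (auto intro!: derivative_eq_intros simp: field_simps)
  then have "(g has_integral (?G b - ?G a)) {a..b}"
    by (intro fundamental_theorem_of_calculus[OF assms(1)])
  also have "?G b - ?G a = simpson a b g"
    unfolding g_def simpson_def
    by (simp add: field_simps power2_eq_square power3_eq_cube power4_eq_xxxx)
  finally show ?thesis .
qed

text \<open>
  The integrand may take any value at the end points of the element, where derivatives with
  respect to \<open>\<rho>\<close> do not exist in general.
\<close>

lemma affine_product_has_integral_simpson:
  fixes p q r :: "real \<Rightarrow> real"
  assumes "affine_on {a..b} p" "affine_on {a..b} q" "affine_on {a..b} r" "a \<le> b"
    and f: "\<And>x. x \<in> {a<..<b} \<Longrightarrow> f x = c * (p x * q x * r x)"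
  shows "(f has_integral c * simpson a b (\<lambda>x. p x * q x * r x)) {a..b}"
proof -
  obtain A B where p: "\<And>x. x \<in> {a..b} \<Longrightarrow> p x = A + x * B"
    using assms(1) unfolding affine_on_def by auto
  obtain A' B' where q: "\<And>x. x \<in> {a..b} \<Longrightarrow> q x = A' + x * B'"
    using assms(2) unfolding affine_on_def by auto
  obtain A'' B'' where r: "\<And>x. x \<in> {a..b} \<Longrightarrow> r x = A'' + x * B''"
    using assms(3) unfolding affine_on_def by auto
  define g where "g = (\<lambda>x. A * A' * A'' + (B * A' * A'' + A * B' * A'' + A * A' * B'') * x
      + (B * B' * A'' + B * A' * B'' + A * B' * B'') * x ^ 2 + B * B' * B'' * x ^ 3)"
  have g: "p x * q x * r x = g x" if "x \<in> {a..b}" for x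
    unfolding p[OF that] q[OF that] r[OF that] g_def by algebra
  have "simpson a b (\<lambda>x. p x * q x * r x) = simpson a b g"
    using g[of a] g[of b] g[of "(a + b) / 2"] assms(4) by (simp add: simpson_def)
  moreover have "((\<lambda>x. c * g x) has_integral c * simpson a b g) {a..b}"
    unfolding g_def
    by (intro has_integral_mult_right cubic_has_integral_simpson assms(4))
  moreover have "f x = c * g x" if "x \<in> {a..b} - {a, b}" for x
    using f[of x] g[of x] that by auto
  ultimately show ?thesis
    using has_integral_spike_finite[of "{a, b}" "{a..b}" f "\<lambda>x. c * g x"] by simp
qed

lemma has_real_derivative_simpson:
  assumes "\<And>x. x \<in> {a..b} \<Longrightarrow> ((\<lambda>s. g s x) has_real_derivative g' x) (at t within S)"
    and "a \<le> b"
  shows "((\<lambda>s. simpson a b (g s)) has_real_derivative simpson a b g') (at t within S)"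
  unfolding simpson_def using assms(2)
  by (intro DERIV_cmult DERIV_add assms(1)) auto

section \<open>The elements of the mesh\<close>

lemma node_strict: "J \<ge> 1 \<Longrightarrow> j \<in> {1..J} \<Longrightarrow> node J (j - 1) < node J j"
  by (auto simp: node_def divide_strict_right_mono)

lemma elt_subset:
  assumes "j \<in> {1..J}"
  shows "elt J j \<subseteq> {0..1}"
proof -
  have "0 \<le> node J (j - 1)" "node J j \<le> 1"
    using assms by (auto simp: node_def field_simps)
  then show ?thesis
    by (auto simp: elt_def)
qed

lemma Vh_affine_on: "f \<in> Vh D J \<Longrightarrow> j \<in> {1..J} \<Longrightarrow> affine_on (elt J j) f"
  unfolding Vh_def affine_on_def by (simp add: mult.commute)

lemma Vh_bdry_affine_on: "f \<in> Vh_bdry D J \<Longrightarrow> j \<in> {1..J} \<Longrightarrow> affine_on (elt J j) f"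
  by (rule affine_on_vec) (auto simp: Vh_bdry_def intro: Vh_affine_on)

lemma Vh_diff_const:
  assumes "f \<in> Vh D J"
  shows "(\<lambda>x. f x - c) \<in> Vh D J"
proof -
  have "\<exists>a b. \<forall>\<rho>\<in>elt J j. f \<rho> - c = a + b * \<rho>" if "j \<in> {1..J}" for j
    using affine_on_diff_const[OF Vh_affine_on[OF assms that], of c]
    by (simp add: affine_on_def mult.commute)
  then show ?thesis
    using assms by (auto simp: Vh_def intro!: continuous_intros)
qed

lemma integral_sum_elements:
  fixes f :: "real \<Rightarrow> real"
  assumes "J \<ge> 1" and "\<And>j. j \<in> {1..J} \<Longrightarrow> f integrable_on elt J j"
  shows "integral {0..1} f = (\<Sum>j=1..J. integral (elt J j) f)"
proof -
  let ?I = "\<lambda>j. integral (elt J j) f"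
  have "(f has_integral (\<Sum>j=1..n. ?I j)) {0..node J n}" if "n \<le> J" for n
    using that
  proof (induction n)
    case 0
    then show ?case using has_integral_refl(2)[of f 0] by (simp add: node_def)
  next
    case (Suc n)
    have "(f has_integral ?I (Suc n)) {node J n..node J (Suc n)}"
      using integrable_integral[OF assms(2), of "Suc n"] Suc.prems by (simp add: elt_def)
    then have "(f has_integral (\<Sum>j=1..n. ?I j) + ?I (Suc n)) {0..node J (Suc n)}"
      using Suc assms(1)
      by (intro has_integral_combine[of 0 "node J n"]) (auto simp: node_def divide_right_mono)
    then show ?case by simp
  qed
  from this[of J] show ?thesis
    using assms(1) by (auto simp: node_def intro: integral_unique)
qed

section \<open>Derivatives in time\<close>

lemma dt_eq:
  fixes u :: "real \<Rightarrow> real \<Rightarrow> 'a::real_normed_vector"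
  assumes "t \<in> {0<..T}" "((\<lambda>s. u s x) has_vector_derivative u') (at t within {0..T})"
  shows "dt T u t x = u'"
proof -
  have "at t within {0..T} \<noteq> bot"
    using assms(1) by (auto simp: trivial_limit_within)
  then show ?thesis
    unfolding dt_def using assms(2) by (rule vector_derivative_within)
qed

lemma has_vector_derivative_dt:
  fixes u :: "real \<Rightarrow> real \<Rightarrow> 'a::real_normed_vector"
  assumes "(\<lambda>s. u s x) differentiable (at t within {0..T})"
  shows "((\<lambda>s. u s x) has_vector_derivative dt T u t x) (at t within {0..T})"
  unfolding dt_def using assms by (simp add: vector_derivative_works)

text \<open>
  Interpolation between the end points has coefficients independent of time, so it commutes with
  the time derivative.
\<close>

lemma affine_on_dt:
  fixes u :: "real \<Rightarrow> real \<Rightarrow> 'a::real_normed_vector"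
  assumes "t \<in> {0<..T}" "a < b"
    and aff: "\<And>s. s \<in> {0..T} \<Longrightarrow> affine_on {a..b} (u s)"
    and diff: "\<And>x. x \<in> {a..b} \<Longrightarrow> (\<lambda>s. u s x) differentiable (at t within {0..T})"
  shows "affine_on {a..b} (dt T u t)"
proof (rule affine_onI_point_slope)
  fix x assume x: "x \<in> {a..b}"
  let ?d = "\<lambda>x. dt T u t x"
  have "((\<lambda>s. u s a) has_vector_derivative ?d a) (at t within {0..T})"
    "((\<lambda>s. u s b) has_vector_derivative ?d b) (at t within {0..T})"
    using assms(2) by (auto intro!: has_vector_derivative_dt diff)
  then have "((\<lambda>s. u s a + (x - a) *\<^sub>R ((u s b - u s a) /\<^sub>R (b - a))) has_vector_derivative
          ?d a + (x - a) *\<^sub>R ((?d b - ?d a) /\<^sub>R (b - a))) (at t within {0..T})"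
    by (intro has_vector_derivative_add has_vector_derivative_diff
        bounded_linear.has_vector_derivative[OF bounded_linear_scaleR_right])
  then have "((\<lambda>s. u s x) has_vector_derivative
          ?d a + (x - a) *\<^sub>R ((?d b - ?d a) /\<^sub>R (b - a))) (at t within {0..T})"
    by (rule has_vector_derivative_transform[rotated 2])
      (use assms(1) affine_on_interpolation[OF aff assms(2) x] in auto)
  then show "?d x = ?d a + (x - a) *\<^sub>R ((?d b - ?d a) /\<^sub>R (b - a))"
    by (rule dt_eq[OF assms(1)])
qed

lemma has_real_derivative_norm:
  fixes w :: "real \<Rightarrow> 'a::real_inner"
  assumes "(w has_vector_derivative w') (at t within S)" "w t \<noteq> 0"
  shows "((\<lambda>s. norm (w s)) has_real_derivative w' \<bullet> (w t /\<^sub>R norm (w t))) (at t within S)"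
proof -
  have "((\<lambda>s. norm (w s)) has_derivative (\<lambda>h. (h *\<^sub>R w') \<bullet> sgn (w t))) (at t within S)"
    using has_derivative_compose[OF assms(1)[unfolded has_vector_derivative_def]
        has_derivative_norm[OF assms(2)]] .
  moreover have "(\<lambda>h. (h *\<^sub>R w') \<bullet> sgn (w t)) = (*) (w' \<bullet> (w t /\<^sub>R norm (w t)))"
    by (auto simp: sgn_div_norm)
  ultimately show ?thesis
    by (simp add: has_field_derivative_def)
qed

section \<open>The energy of an element\<close>

text \<open>
  Simpson's rule turns both sides into expressions in point values, which are compared by the
  product rule. The functions \<open>F1\<close> and \<open>F2\<close> are the integrands of the two terms of \<open>eq_S2\<close> with
  time derivatives, for the test function \<open>vk t - c\<close>. The edge has to be nondegenerate for its
  length to be differentiable in time.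
\<close>

lemma element_energy_has_derivative:
  fixes X :: "real \<Rightarrow> real \<Rightarrow> real ^ 2" and vk :: "real \<Rightarrow> real \<Rightarrow> real"
    and c :: real
  assumes t: "t \<in> {0<..T}" and ab: "a < b"
    and affX: "\<And>s. s \<in> {0..T} \<Longrightarrow> affine_on {a..b} (X s)"
    and affvk: "\<And>s. s \<in> {0..T} \<Longrightarrow> affine_on {a..b} (vk s)"
    and diffX: "\<And>x. x \<in> {a..b} \<Longrightarrow> (\<lambda>s. X s x) differentiable (at t within {0..T})"
    and diffvk: "\<And>x. x \<in> {a..b} \<Longrightarrow> (\<lambda>s. vk s x) differentiable (at t within {0..T})"
    and nz: "X t b \<noteq> X t a"
  defines "F1 \<equiv> \<lambda>\<rho>. ((X t \<rho> \<bullet> e1) * dt T vk t \<rho>) * ((vk t \<rho> - c) * norm (d\<rho> (X t) \<rho>))"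
    and "F2 \<equiv> \<lambda>\<rho>. ((dt T X t \<rho> \<bullet> e1) * norm (d\<rho> (X t) \<rho>)
                    + (X t \<rho> \<bullet> e1) * (d\<rho> (dt T X t) \<rho> \<bullet> tangent (X t) \<rho>))
                  * ((vk t \<rho> - c) * (vk t \<rho> - c))"
    and "e \<equiv> \<lambda>s \<rho>. (X s \<rho> \<bullet> e1) * (vk s \<rho> - c)\<^sup>2 * norm (d\<rho> (X s) \<rho>)"
  shows "F1 integrable_on {a..b}" and "F2 integrable_on {a..b}"
    and "\<And>s. s \<in> {0..T} \<Longrightarrow> e s integrable_on {a..b}"
    and "((\<lambda>s. integral {a..b} (e s)) has_real_derivative
           2 * integral {a..b} F1 + integral {a..b} F2) (at t within {0..T})"
proof -
  have tT: "t \<in> {0..T}" using t by auto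
  \<comment> \<open>\<open>w s\<close> is the constant value of \<open>d\<rho> (X s)\<close> inside the element, and \<open>N'\<close> is the time derivative
    of its norm.\<close>
  define w where "w s = (X s b - X s a) /\<^sub>R (b - a)" for s
  define w' where "w' = (dt T X t b - dt T X t a) /\<^sub>R (b - a)"
  define N' where "N' = w' \<bullet> (w t /\<^sub>R norm (w t))"
  define p where "p s x = X s x \<bullet> e1" for s x
  define q where "q s x = vk s x - c" for s x
  define p' where "p' x = dt T X t x \<bullet> e1" for x
  define q' where "q' x = dt T vk t x" for x
  define E where "E s = norm (w s) * simpson a b (\<lambda>x. p s x * q s x * q s x)" for s
  define S1 where "S1 = simpson a b (\<lambda>x. p t x * q' x * q t x)"
  define S2 where "S2 = simpson a b (\<lambda>x. p' x * q t x * q t x)"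
  define S3 where "S3 = simpson a b (\<lambda>x. p t x * q t x * q t x)"
  note affdX = affine_on_dt[OF t ab affX diffX]
  note affdvk = affine_on_dt[OF t ab affvk diffvk]
  have p: "affine_on {a..b} (p s)" and q: "affine_on {a..b} (q s)" if "s \<in> {0..T}" for s
    unfolding p_def q_def using that
    by (auto intro!: affine_on_inner affine_on_diff_const affX affvk)
  have p': "affine_on {a..b} p'" and q': "affine_on {a..b} q'"
    unfolding p'_def q'_def using affdX affdvk by (auto intro!: affine_on_inner)
  have dX: "d\<rho> (X s) x = w s" if "s \<in> {0..T}" "x \<in> {a<..<b}" for s x
    unfolding w_def using affine_on_d\<rho>[OF affX] that by blast
  have dXt: "d\<rho> (dt T X t) x = w'" if "x \<in> {a<..<b}" for x
    unfolding w'_def using affine_on_d\<rho>[OF affdX that] by blast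
  have wt: "w t \<noteq> 0"
    using nz ab by (simp add: w_def)
  have F1: "(F1 has_integral norm (w t) * S1) {a..b}"
    unfolding S1_def
    by (rule affine_product_has_integral_simpson[OF p[OF tT] q' q[OF tT] less_imp_le[OF ab]])
      (simp add: F1_def p_def q_def q'_def dX[OF tT])
  have e: "(e s has_integral E s) {a..b}" if "s \<in> {0..T}" for s
    unfolding E_def
    by (rule affine_product_has_integral_simpson[OF p[OF that] q[OF that] q[OF that]
          less_imp_le[OF ab]])
      (simp add: e_def p_def q_def dX[OF that] power2_eq_square)
  have "((\<lambda>x. norm (w t) * (p' x * q t x * q t x)) has_integral norm (w t) * S2) {a..b}"
    unfolding S2_def
    by (rule affine_product_has_integral_simpson[OF p' q[OF tT] q[OF tT] less_imp_le[OF ab]]) simp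
  moreover have "((\<lambda>x. N' * (p t x * q t x * q t x)) has_integral N' * S3) {a..b}"
    unfolding S3_def
    by (rule affine_product_has_integral_simpson[OF p[OF tT] q[OF tT] q[OF tT]
          less_imp_le[OF ab]]) simp
  ultimately have "((\<lambda>x. norm (w t) * (p' x * q t x * q t x) + N' * (p t x * q t x * q t x))
      has_integral norm (w t) * S2 + N' * S3) {a..b}"
    by (rule has_integral_add)
  then have F2: "(F2 has_integral norm (w t) * S2 + N' * S3) {a..b}"
    by (rule has_integral_spike_finite[of "{a, b}", rotated 2])
      (auto simp: F2_def p_def q_def p'_def N'_def tangent_def dX[OF tT] dXt algebra_simps)
  show "F1 integrable_on {a..b}" "F2 integrable_on {a..b}"
    by (rule has_integral_integrable[OF F1], rule has_integral_integrable[OF F2])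
  show "e s integrable_on {a..b}" if "s \<in> {0..T}" for s
    using e[OF that] by (rule has_integral_integrable)
  have dp: "((\<lambda>s. p s x) has_real_derivative p' x) (at t within {0..T})"
    if "x \<in> {a..b}" for x
    unfolding p_def p'_def has_real_derivative_iff_has_vector_derivative
    by (intro bounded_linear.has_vector_derivative[OF bounded_linear_inner_left]
        has_vector_derivative_dt diffX that)
  have dq: "((\<lambda>s. q s x) has_real_derivative q' x) (at t within {0..T})"
    if "x \<in> {a..b}" for x
  proof -
    have "((\<lambda>s. vk s x) has_real_derivative q' x) (at t within {0..T})"
      unfolding q'_def has_real_derivative_iff_has_vector_derivative
      by (intro has_vector_derivative_dt diffvk that)
    from DERIV_diff[OF this DERIV_const] show ?thesis
      unfolding q_def by simp
  qed
  have "((\<lambda>s. p s x * q s x * q s x) has_real_derivative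
      p' x * q t x * q t x + 2 * (p t x * q' x * q t x)) (at t within {0..T})"
    if "x \<in> {a..b}" for x
    by (rule DERIV_cong[OF DERIV_mult[OF DERIV_mult[OF dp[OF that] dq[OF that]] dq[OF that]]])
      (simp add: algebra_simps)
  then have "((\<lambda>s. simpson a b (\<lambda>x. p s x * q s x * q s x)) has_real_derivative
      simpson a b (\<lambda>x. p' x * q t x * q t x + 2 * (p t x * q' x * q t x))) (at t within {0..T})"
    by (rule has_real_derivative_simpson) (use ab in auto)
  moreover have "simpson a b (\<lambda>x. p' x * q t x * q t x + 2 * (p t x * q' x * q t x)) = S2 + 2 * S1"
    unfolding S1_def S2_def simpson_def by (simp add: algebra_simps)
  ultimately have dS: "((\<lambda>s. simpson a b (\<lambda>x. p s x * q s x * q s x)) has_real_derivative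
      S2 + 2 * S1) (at t within {0..T})"
    by simp
  have "((\<lambda>s. X s b) has_vector_derivative dt T X t b) (at t within {0..T})"
    "((\<lambda>s. X s a) has_vector_derivative dt T X t a) (at t within {0..T})"
    using ab by (auto intro!: has_vector_derivative_dt diffX)
  then have "(w has_vector_derivative w') (at t within {0..T})"
    unfolding w_def w'_def
    by (intro bounded_linear.has_vector_derivative[OF bounded_linear_scaleR_right]
        has_vector_derivative_diff)
  then have dN: "((\<lambda>s. norm (w s)) has_real_derivative N') (at t within {0..T})"
    unfolding N'_def by (rule has_real_derivative_norm) (rule wt)
  have "(E has_real_derivative 2 * (norm (w t) * S1) + (norm (w t) * S2 + N' * S3))
      (at t within {0..T})"
    unfolding E_def
    by (rule DERIV_cong[OF DERIV_mult[OF dN dS]]) (simp add: S3_def algebra_simps)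
  then have "(E has_real_derivative 2 * integral {a..b} F1 + integral {a..b} F2)
      (at t within {0..T})"
    using F1 F2 by (simp add: integral_unique)
  then show "((\<lambda>s. integral {a..b} (e s)) has_real_derivative
      2 * integral {a..b} F1 + integral {a..b} F2) (at t within {0..T})"
    by (rule has_field_derivative_transform_within[OF _ zero_less_one tT])
      (use e in \<open>auto intro: integral_unique[symmetric]\<close>)
qed

lemma admissible_element_nondegenerate:
  assumes "J \<ge> 1" "j \<in> {1..J}" "admissible D J X" "affine_on (elt J j) X"
  shows "X (node J j) \<noteq> X (node J (j - 1))"
proof -
  let ?a = "node J (j - 1)" and ?b = "node J j"
  have ab: "?a < ?b"
    by (rule node_strict) fact+
  then have "(X has_vector_derivative (X ?b - X ?a) /\<^sub>R (?b - ?a)) (at ?a within {?a..?b})"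
    using assms(4) by (intro affine_on_has_vector_derivative_within) (auto simp: elt_def)
  then have "vector_derivative X (at ?a within elt J j) = (X ?b - X ?a) /\<^sub>R (?b - ?a)"
    unfolding elt_def using ab by (intro vector_derivative_within_closed_interval) auto
  moreover have "?a \<in> elt J j"
    using ab by (simp add: elt_def)
  then have "norm (vector_derivative X (at ?a within elt J j)) > 0"
    using assms(2,3) by (auto simp: admissible_def)
  ultimately show ?thesis
    by auto
qed

section \<open>The energy identity\<close>

lemma energy_has_derivative:
  assumes J: "J \<ge> 1"
    and adm: "\<forall>t\<in>{0..T}. admissible D J (X t)"
    and sol: "semidiscrete_solution D J vk0 T V vk X kp"
    and t: "t \<in> {0<..T}"
  shows "((\<lambda>s. energy vk0 (X s) (vk s)) has_real_derivative
      2 * pi * (L2 (\<lambda>\<rho>. (X t \<rho> \<bullet> e1) * dt T vk t \<rho>) (\<lambda>\<rho>. (vk t \<rho> - vk0) * norm (d\<rho> (X t) \<rho>))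
       + 1 / 2 * L2 (\<lambda>\<rho>. (dt T X t \<rho> \<bullet> e1) * norm (d\<rho> (X t) \<rho>)
                     + (X t \<rho> \<bullet> e1) * (d\<rho> (dt T X t) \<rho> \<bullet> tangent (X t) \<rho>))
                    (\<lambda>\<rho>. (vk t \<rho> - vk0) * (vk t \<rho> - vk0)))) (at t within {0..T})"
proof -
  let ?F1 = "\<lambda>\<rho>. ((X t \<rho> \<bullet> e1) * dt T vk t \<rho>) * ((vk t \<rho> - vk0) * norm (d\<rho> (X t) \<rho>))"
  let ?F2 = "\<lambda>\<rho>. ((dt T X t \<rho> \<bullet> e1) * norm (d\<rho> (X t) \<rho>)
             + (X t \<rho> \<bullet> e1) * (d\<rho> (dt T X t) \<rho> \<bullet> tangent (X t) \<rho>))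
            * ((vk t \<rho> - vk0) * (vk t \<rho> - vk0))"
  let ?e = "\<lambda>s \<rho>. (X s \<rho> \<bullet> e1) * (vk s \<rho> - vk0)\<^sup>2 * norm (d\<rho> (X s) \<rho>)"
  have tT: "t \<in> {0..T}" using t by auto
  have X: "X s \<in> Vh_bdry D J" and vk: "vk s \<in> Vh D J" if "s \<in> {0..T}" for s
    using sol that by (cases "s = 0"; auto simp: semidiscrete_solution_def)+
  have elements: "?F1 integrable_on elt J j" "?F2 integrable_on elt J j"
      "\<And>s. s \<in> {0..T} \<Longrightarrow> ?e s integrable_on elt J j"
      "((\<lambda>s. integral (elt J j) (?e s)) has_real_derivative
         2 * integral (elt J j) ?F1 + integral (elt J j) ?F2) (at t within {0..T})"
    if j: "j \<in> {1..J}" for j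
  proof -
    let ?a = "node J (j - 1)" and ?b = "node J j"
    have elt: "elt J j = {?a..?b}"
      by (simp add: elt_def)
    have aff: "affine_on {?a..?b} (X s)" "affine_on {?a..?b} (vk s)" if "s \<in> {0..T}" for s
      using Vh_bdry_affine_on[OF X[OF that] j] Vh_affine_on[OF vk[OF that] j]
      unfolding elt by auto
    have diff: "(\<lambda>s. X s x) differentiable (at t within {0..T})"
      "(\<lambda>s. vk s x) differentiable (at t within {0..T})" if "x \<in> {?a..?b}" for x
      using sol t elt_subset[OF j] that unfolding semidiscrete_solution_def elt by blast+
    have nz: "X t ?b \<noteq> X t ?a"
      using admissible_element_nondegenerate[OF J j, of D "X t"] adm tT aff(1)[OF tT] elt by simp
    note element = element_energy_has_derivative[where X = X and vk = vk and c = vk0,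
        OF t node_strict[OF J j] aff diff nz, folded elt]
    show "?F1 integrable_on elt J j" "?F2 integrable_on elt J j"
      "((\<lambda>s. integral (elt J j) (?e s)) has_real_derivative
         2 * integral (elt J j) ?F1 + integral (elt J j) ?F2) (at t within {0..T})"
      by (rule element; assumption)+
    show "?e s integrable_on elt J j" if "s \<in> {0..T}" for s
      by (rule element(3)[OF _ _ _ _ that])
  qed
  have en: "energy vk0 (X s) (vk s) = pi * (\<Sum>j=1..J. integral (elt J j) (?e s))"
    if "s \<in> {0..T}" for s
    unfolding energy_def using integral_sum_elements[OF J elements(3)[OF _ that]] by simp
  have int_F1: "integral {0..1} ?F1 = (\<Sum>j=1..J. integral (elt J j) ?F1)"
    by (rule integral_sum_elements[OF J elements(1)])
  have int_F2: "integral {0..1} ?F2 = (\<Sum>j=1..J. integral (elt J j) ?F2)"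
    by (rule integral_sum_elements[OF J elements(2)])
  have factor: "pi * (2 * x + y) = 2 * pi * (x + 1 / 2 * y)" for x y :: real
    by (simp add: algebra_simps)
  have "((\<lambda>s. pi * (\<Sum>j=1..J. integral (elt J j) (?e s))) has_real_derivative
      pi * (\<Sum>j=1..J. 2 * integral (elt J j) ?F1 + integral (elt J j) ?F2)) (at t within {0..T})"
    by (intro DERIV_cmult DERIV_sum elements(4))
  then have "((\<lambda>s. energy vk0 (X s) (vk s)) has_real_derivative
      pi * (\<Sum>j=1..J. 2 * integral (elt J j) ?F1 + integral (elt J j) ?F2)) (at t within {0..T})"
    by (rule has_field_derivative_transform_within[OF _ zero_less_one tT]) (simp add: en)
  also have "pi * (\<Sum>j=1..J. 2 * integral (elt J j) ?F1 + integral (elt J j) ?F2)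
      = 2 * pi * (integral {0..1} ?F1 + 1 / 2 * integral {0..1} ?F2)"
    by (simp only: sum.distrib sum_distrib_left[symmetric] factor int_F1 int_F2)
  finally show ?thesis
    unfolding L2_def inner_real_def .
qed

lemma dissipation_nonneg:
  assumes "admissible D J X" "X \<in> Vh_bdry D J"
  shows "L2 (\<lambda>\<rho>. (X \<rho> \<bullet> e1) * V \<rho>) (\<lambda>\<rho>. V \<rho> * norm (d\<rho> X \<rho>)) \<ge> 0"
proof -
  have radius: "X \<rho> \<bullet> e1 \<ge> 0" if "\<rho> \<in> {0..1}" for \<rho>
    using assms that unfolding admissible_def Vh_bdry_def
    by (cases "\<rho> \<in> bdry D") (auto intro: less_imp_le)
  have nonneg: "((X \<rho> \<bullet> e1) * V \<rho>) \<bullet> (V \<rho> * norm (d\<rho> X \<rho>)) \<ge> 0" if "\<rho> \<in> {0..1}" for \<rho>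
  proof -
    have "((X \<rho> \<bullet> e1) * V \<rho>) \<bullet> (V \<rho> * norm (d\<rho> X \<rho>))
        = (X \<rho> \<bullet> e1) * ((V \<rho>)\<^sup>2 * norm (d\<rho> X \<rho>))"
      by (simp add: power2_eq_square)
    also have "\<dots> \<ge> 0"
      by (intro mult_nonneg_nonneg radius[OF that]) auto
    finally show ?thesis .
  qed
  \<comment> \<open>If the integrand is not integrable, then the integral has the default value \<open>0\<close>.\<close>
  show ?thesis
    unfolding L2_def
  proof (cases "(\<lambda>\<rho>. ((X \<rho> \<bullet> e1) * V \<rho>) \<bullet> (V \<rho> * norm (d\<rho> X \<rho>))) integrable_on {0..1}")
    case True
    then show "integral {0..1} (\<lambda>\<rho>. ((X \<rho> \<bullet> e1) * V \<rho>) \<bullet> (V \<rho> * norm (d\<rho> X \<rho>))) \<ge> 0"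
      by (rule integral_nonneg) (rule nonneg)
  next
    case False
    show "integral {0..1} (\<lambda>\<rho>. ((X \<rho> \<bullet> e1) * V \<rho>) \<bullet> (V \<rho> * norm (d\<rho> X \<rho>))) \<ge> 0"
      unfolding not_integrable_integral[OF False] by simp
  qed
qed

theorem theorem3p1:
  fixes D :: domain and J :: nat and vk0 T :: real
    and V vk kp :: "real \<Rightarrow> real \<Rightarrow> real" and X :: "real \<Rightarrow> real \<Rightarrow> real ^ 2"
  assumes "J \<ge> 1"
    and "\<forall>t\<in>{0..T}. admissible D J (X t)"
    and "semidiscrete_solution D J vk0 T V vk X kp"
  shows "\<forall>t\<in>{0<..T}.
      ((\<lambda>s. energy vk0 (X s) (vk s)) has_real_derivative
         - 2 * pi * L2 (\<lambda>\<rho>. (X t \<rho> \<bullet> e1) * V t \<rho>) (\<lambda>\<rho>. V t \<rho> * norm (d\<rho> (X t) \<rho>)))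
        (at t within {0..T})
    \<and> - 2 * pi * L2 (\<lambda>\<rho>. (X t \<rho> \<bullet> e1) * V t \<rho>) (\<lambda>\<rho>. V t \<rho> * norm (d\<rho> (X t) \<rho>)) \<le> 0"
proof
  fix t assume t: "t \<in> {0<..T}"
  then have tT: "t \<in> {0..T}" by auto
  let ?r = "\<lambda>\<rho>. X t \<rho> \<bullet> e1" and ?n = "\<lambda>\<rho>. norm (d\<rho> (X t) \<rho>)"
  let ?\<zeta> = "\<lambda>\<rho>. vk t \<rho> - vk0"
  let ?diss = "L2 (\<lambda>\<rho>. ?r \<rho> * V t \<rho>) (\<lambda>\<rho>. V t \<rho> * ?n \<rho>)"
  let ?grad = "L2 (\<lambda>\<rho>. ?r \<rho> * d\<rho> (vk t) \<rho>) (\<lambda>\<rho>. d\<rho> (V t) \<rho> * inverse (?n \<rho>))"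
  let ?curv = "L2 (\<lambda>\<rho>. (normal (X t) \<rho> \<bullet> e1) * kp t \<rho> * ?\<zeta> \<rho>) (\<lambda>\<rho>. V t \<rho> * ?n \<rho>)"
  let ?cub = "L2 (\<lambda>\<rho>. ?r \<rho> * ((vk t \<rho>)\<^sup>2 - vk0\<^sup>2) * vk t \<rho>) (\<lambda>\<rho>. V t \<rho> * ?n \<rho>)"
  let ?time = "L2 (\<lambda>\<rho>. ?r \<rho> * dt T vk t \<rho>) (\<lambda>\<rho>. ?\<zeta> \<rho> * ?n \<rho>)
       + 1 / 2 * L2 (\<lambda>\<rho>. (dt T X t \<rho> \<bullet> e1) * ?n \<rho>
                     + ?r \<rho> * (d\<rho> (dt T X t) \<rho> \<bullet> tangent (X t) \<rho>)) (\<lambda>\<rho>. ?\<zeta> \<rho> * ?\<zeta> \<rho>)"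
  have mem: "V t \<in> Vh D J" "?\<zeta> \<in> Vh D J" "X t \<in> Vh_bdry D J"
    and S1: "eq_S1 D J vk0 (V t) (vk t) (X t) (kp t)"
    and S2: "eq_S2 D J vk0 (V t) (vk t) (X t) (kp t) (dt T vk t) (dt T X t)"
    using assms(3) t by (auto simp: semidiscrete_solution_def intro: Vh_diff_const)
  have d\<zeta>: "d\<rho> ?\<zeta> = d\<rho> (vk t)"
    by (rule ext) (simp add: d\<rho>_def vector_derivative_def has_vector_derivative_diff_const)
  \<comment> \<open>The remaining terms of \<open>eq_S2\<close> have, pointwise, the integrands of the terms of \<open>eq_S1\<close>, except
    for the last one, which cancels because \<open>?\<zeta>\<close> and \<open>vk t\<close> have the same derivative.\<close>
  have "L2 (\<lambda>\<rho>. ?r \<rho> * d\<rho> (V t) \<rho>) (\<lambda>\<rho>. d\<rho> ?\<zeta> \<rho> * inverse (?n \<rho>)) = ?grad"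
    "L2 (\<lambda>\<rho>. (normal (X t) \<rho> \<bullet> e1) * kp t \<rho> * V t \<rho>) (\<lambda>\<rho>. ?\<zeta> \<rho> * ?n \<rho>) = ?curv"
    "L2 (\<lambda>\<rho>. ?r \<rho> * (vk t \<rho> + vk0) * vk t \<rho> * V t \<rho>) (\<lambda>\<rho>. ?\<zeta> \<rho> * ?n \<rho>) = ?cub"
    "L2 (\<lambda>\<rho>. ?r \<rho> * (dt T X t \<rho> \<bullet> tangent (X t) \<rho>))
        (\<lambda>\<rho>. d\<rho> (vk t) \<rho> * ?\<zeta> \<rho> - ?\<zeta> \<rho> * d\<rho> ?\<zeta> \<rho>) = 0"
    unfolding L2_def d\<zeta>
    by (auto intro!: arg_cong[where f = "integral {0..1}"] simp: algebra_simps power2_eq_square)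
  with S2[unfolded eq_S2_def, rule_format, OF mem(2)]
  have "?time + ?grad - 2 * ?curv - 1 / 2 * ?cub = 0"
    by simp
  moreover from S1[unfolded eq_S1_def, rule_format, OF mem(1)]
  have "?diss - ?grad + 2 * ?curv + 1 / 2 * ?cub = 0" .
  ultimately have time: "?time = - ?diss"
    by linarith
  have "((\<lambda>s. energy vk0 (X s) (vk s)) has_real_derivative 2 * pi * ?time) (at t within {0..T})"
    by (rule energy_has_derivative[OF assms t])
  moreover have "?diss \<ge> 0"
    by (rule dissipation_nonneg[OF _ mem(3)]) (use assms(2) tT in blast)
  ultimately show "((\<lambda>s. energy vk0 (X s) (vk s)) has_real_derivative - 2 * pi * ?diss)
        (at t within {0..T}) \<and> - 2 * pi * ?diss \<le> 0"
    unfolding time by simp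
qed

end
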